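(* Let $Q_n$ denote the $n$-dimensional hypercube graph and let $\mathrm{ex}(Q_n,C_4)$ denote the maximum number of edges of a subgraph of $Q_n$ containing no cycle of length four. Then (i) $\mathrm{ex}(Q_7,C_4)\ge 304$; (ii) $\mathrm{ex}(Q_8,C_4)\ge 680$.
   Context: The hypercube $Q_n$ has vertex set $\{0,1\}^n$, two vertices being adjacent iff they differ in exactly one coordinate; it has $2^n$ vertices and $n2^{n-1}$ edges. $\mathrm{ex}(Q_n,C_4)=\max\{|E(G)|: G\subseteq Q_n,\ G \text{ contains no } C_4\}$. *)

theory Defs
  imports Main
begin

text \<open>A simple graph is a pair of a vertex set and a set of two-element vertex sets.\<close>

type_synonym 'a graph = "'a set \<times> 'a set set"

abbreviation verts :: "'a graph \<Rightarrow> 'a set" where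
  "verts G \<equiv> fst G"

abbreviation edges :: "'a graph \<Rightarrow> 'a set set" where
  "edges G \<equiv> snd G"

definition simple_graph :: "'a graph \<Rightarrow> bool" where
  "simple_graph G \<longleftrightarrow> (\<forall>e\<in>edges G. e \<subseteq> verts G \<and> card e = 2)"

definition subgraph :: "'a graph \<Rightarrow> 'a graph \<Rightarrow> bool" where
  "subgraph G H \<longleftrightarrow> simple_graph G \<and> verts G \<subseteq> verts H \<and> edges G \<subseteq> edges H"

text \<open>\<open>G\<close> contains a not necessarily induced copy of \<open>F\<close>.\<close>

definition contains_copy :: "'a graph \<Rightarrow> 'b graph \<Rightarrow> bool" where
  "contains_copy G F \<longleftrightarrow>
     (\<exists>f. inj_on f (verts F) \<and> f ` verts F \<subseteq> verts G \<and> (\<forall>e\<in>edges F. f ` e \<in> edges G))"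

text \<open>The cycle of length \<open>k\<close>; only meaningful for \<open>k \<ge> 3\<close>.\<close>

definition cycle_graph :: "nat \<Rightarrow> nat graph" where
  "cycle_graph k = ({..<k}, {{i, (i + 1) mod k} | i. i < k})"

definition hypercube :: "nat \<Rightarrow> bool list graph" where
  "hypercube n =
     ({x. length x = n},
      {{x, y} | x y. length x = n \<and> length y = n \<and> card {i. i < n \<and> x ! i \<noteq> y ! i} = 1})"

text \<open>The maximum is over a finite nonempty set when \<open>H\<close> is a finite simple graph and \<open>F\<close> has
  at least one edge.\<close>

definition ex_num :: "'a graph \<Rightarrow> 'b graph \<Rightarrow> nat" where
  "ex_num H F = Max {card (edges G) | G. subgraph G H \<and> \<not> contains_copy G F}"

end

theory Submission
  imports Defs
begin

text \<open>Vertices of the cube are coded by natural numbers below \<open>2 ^ n\<close>, coordinate \<open>i\<close> being bit \<open>i\<close>.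
  A subgraph is coded by one mask per direction: bit \<open>v\<close> of the \<open>i\<close>-th mask says that the edge from
  \<open>v\<close> to \<open>v + 2 ^ i\<close> is present, where bit \<open>i\<close> of \<open>v\<close> is clear. Every four-cycle of the cube is a
  square \<open>v, v + 2 ^ i, v + 2 ^ i + 2 ^ j, v + 2 ^ j\<close>, so the absence of four-cycles in directions
  \<open>i\<close>, \<open>j\<close> amounts to the vanishing of the conjunction of two masks and two shifted masks. The
  bounds follow from explicit masks, which were found by simulated annealing over the subgraphs
  invariant under a random group of automorphisms of the cube.\<close>

section \<open>Lower bounds on the extremal number\<close>

text \<open>\<open>Max\<close> bounds its members only over a finite set; the values here are finite
  in number because none exceeds \<open>card (edges H)\<close>.\<close>

lemma card_le_ex_num:
  assumes "finite (edges H)" "subgraph G H" "\<not> contains_copy G F"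
  shows "card (edges G) \<le> ex_num H F"
proof -
  let ?A = "{card (edges G) | G. subgraph G H \<and> \<not> contains_copy G F}"
  have "?A \<subseteq> {..card (edges H)}"
    using assms(1) by (auto simp: subgraph_def card_mono)
  then have "finite ?A"
    using finite_subset by blast
  then show ?thesis
    unfolding ex_num_def using assms(2,3) by (intro Max_ge) blast+
qed

lemma finite_edges_hypercube: "finite (edges (hypercube n))"
proof -
  have "edges (hypercube n) \<subseteq> Pow {x. length x = n}"
    by (auto simp: hypercube_def)
  then show ?thesis
    using finite_lists_length_eq[of "UNIV :: bool set" n] finite_subset by fastforce
qed

section \<open>Cube vertices as natural numbers\<close>

definition vec :: "nat \<Rightarrow> nat \<Rightarrow> bool list" where
  "vec n v = map (bit v) [0..<n]"

lemma length_vec [simp]: "length (vec n v) = n"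
  by (simp add: vec_def)

lemma nth_vec [simp]: "i < n \<Longrightarrow> vec n v ! i = bit v i"
  by (simp add: vec_def)

lemma bit_imp_less_of_less_exp:
  fixes v :: nat
  assumes "v < 2 ^ n" "bit v i"
  shows "i < n"
  using assms by (metis bit_take_bit_iff take_bit_nat_eq_self)

lemma vec_eq_iff:
  assumes "v < 2 ^ n" "w < 2 ^ n"
  shows "vec n v = vec n w \<longleftrightarrow> v = w"
proof
  assume eq: "vec n v = vec n w"
  have "bit v i = bit w i" for i
  proof (cases "i < n")
    case True
    then show ?thesis using eq nth_vec by metis
  next
    case False
    then show ?thesis using assms bit_imp_less_of_less_exp by blast
  qed
  then show "v = w" by (simp add: bit_eq_iff)
qed simp

lemma obtain_vec:
  assumes "length x = n"
  obtains v where "v < 2 ^ n" "x = vec n v"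
proof
  \<comment> \<open>\<open>horner_sum of_bool 2\<close> reads the list as binary digits, least
    significant first, and so inverts \<open>vec\<close>.\<close>
  show "horner_sum of_bool 2 x < (2 ^ n :: nat)"
    using horner_sum_of_bool_2_less[of x] assms
    by metis
  show "x = vec n (horner_sum of_bool 2 x)"
    using assms by (auto intro!: nth_equalityI simp: bit_horner_sum_bit_iff)
qed

lemma set_bit_less_exp:
  fixes v :: nat
  assumes "v < 2 ^ n" "i < n"
  shows "set_bit i v < 2 ^ n"
proof -
  have "take_bit n (set_bit i v) = set_bit i v"
    using assms bit_imp_less_of_less_exp by (intro bit_eqI) (auto simp: bit_simps)
  then show ?thesis
    by (simp add: take_bit_nat_eq_self_iff)
qed

lemma unset_bit_commute:
  fixes a :: nat
  shows "unset_bit i (unset_bit j a) = unset_bit j (unset_bit i a)"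
  by (rule bit_eqI) (auto simp: bit_simps)

text \<open>Concerns the two edges in direction \<open>i\<close> of a square in directions
  \<open>i\<close>, \<open>j\<close>: their lower ends are the corners with bit \<open>i\<close>
  clear. An equality of sets hides which corner \<open>a\<close> is.\<close>

lemma unset_bit_flip_bit_cases:
  fixes a :: nat
  assumes "i \<noteq> j"
  shows "{unset_bit i a, unset_bit i (flip_bit j a)} =
    {unset_bit i (unset_bit j a), set_bit j (unset_bit i (unset_bit j a))}"
proof (cases "bit a j")
  case True
  then have "unset_bit i a = set_bit j (unset_bit i (unset_bit j a))"
    "unset_bit i (flip_bit j a) = unset_bit i (unset_bit j a)"
    using assms by (auto intro!: bit_eqI simp: bit_simps)
  then show ?thesis by auto
next
  case False
  then have "unset_bit i a = unset_bit i (unset_bit j a)"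
    "unset_bit i (flip_bit j a) = set_bit j (unset_bit i (unset_bit j a))"
    using assms by (auto intro!: bit_eqI simp: bit_simps)
  then show ?thesis by auto
qed

section \<open>Graphs coded by masks\<close>

definition mask_graph :: "nat list \<Rightarrow> bool list graph" where
  "mask_graph M =
     ({x. length x = length M},
      {{vec (length M) v, vec (length M) (set_bit i v)} | i v. i < length M \<and> bit (M ! i) v})"

text \<open>Indexing an edge in direction \<open>i\<close> by its end with bit \<open>i\<close>
  clear gives each edge a single code; the bound keeps codes where \<open>vec n\<close> is
  injective.\<close>

locale cube_masks =
  fixes M :: "nat list" and n :: nat
  assumes length_masks: "length M = n"
    and base: "i < n \<Longrightarrow> bit (M ! i) v \<Longrightarrow> v < 2 ^ n \<and> \<not> bit v i"
begin

lemma edges_mask_graph: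
  "edges (mask_graph M) =
     (\<lambda>(i, v). {vec n v, vec n (set_bit i v)}) ` (SIGMA i:{..<n}. {v. bit (M ! i) v})"
  by (auto simp: mask_graph_def length_masks image_iff)

lemma verts_mask_graph: "verts (mask_graph M) = {x. length x = n}"
  by (simp add: mask_graph_def length_masks)

lemma subgraph_mask_graph: "subgraph (mask_graph M) (hypercube n)"
proof -
  have "card e = 2 \<and> e \<subseteq> {x. length x = n} \<and> e \<in> edges (hypercube n)"
    if edge: "e \<in> edges (mask_graph M)" for e
proof -
    obtain i v where i: "i < n" "bit (M ! i) v" and e: "e = {vec n v, vec n (set_bit i v)}"
      using edge by (auto simp: edges_mask_graph)
    have "\<not> bit v i" using base i by blast
    then have "{k. k < n \<and> vec n v ! k \<noteq> vec n (set_bit i v) ! k} = {i}"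
      using i(1) by (auto simp: bit_simps)
    then have card: "card {k. k < n \<and> vec n v ! k \<noteq> vec n (set_bit i v) ! k} = 1"
      by simp
    then have "vec n v \<noteq> vec n (set_bit i v)" by auto
    moreover have "e \<in> edges (hypercube n)"
      unfolding hypercube_def e snd_conv using card length_vec by blast
    ultimately show ?thesis by (simp add: e)
  qed
  then show ?thesis
    unfolding subgraph_def simple_graph_def verts_mask_graph
    by (simp add: hypercube_def subset_iff)
qed

lemma card_edges_mask_graph:
  "card (edges (mask_graph M)) = (\<Sum>i<n. card {v. bit (M ! i) v})"
proof -
  have "inj_on (\<lambda>(i, v). {vec n v, vec n (set_bit i v)}) (SIGMA i:{..<n}. {v. bit (M ! i) v})"
  proof (rule inj_onI, clarify)
    fix i v j w
    assume i: "i < n" "bit (M ! i) v" and j: "j < n" "bit (M ! j) w"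
      and eq: "{vec n v, vec n (set_bit i v)} = {vec n w, vec n (set_bit j w)}"
    have less: "v < 2 ^ n" "w < 2 ^ n" "set_bit i v < 2 ^ n" "set_bit j w < 2 ^ n"
      using i j base set_bit_less_exp by blast+
    have clear: "\<not> bit v i" "\<not> bit w j"
      using i j base by blast+
    have "v = w \<and> set_bit i v = set_bit j w \<or> v = set_bit j w \<and> set_bit i v = w"
      using eq less by (auto simp: doubleton_eq_iff vec_eq_iff)
    then show "i = j \<and> v = w"
    proof
      assume vw: "v = w \<and> set_bit i v = set_bit j w"
      moreover have "bit (set_bit i v) i" by (simp add: bit_simps)
      ultimately have "bit (set_bit j w) i" by metis
      then show ?thesis using vw clear by (auto simp: bit_simps)
    next
      \<comment> \<open>Swapped ends are impossible: bit \<open>i\<close>, set in \<open>w\<close>,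
        would persist in \<open>set_bit j w = v\<close>, where it is clear.\<close>
      assume vw: "v = set_bit j w \<and> set_bit i v = w"
      moreover have "bit (set_bit i v) i" by (simp add: bit_simps)
      ultimately have "bit w i" by metis
      then show ?thesis using vw clear by (auto simp: bit_simps)
    qed
  qed
  moreover have "finite {v. bit (M ! i) v}" if "i < n" for i
    using base[OF that] by (auto intro: finite_subset[of _ "{..<2 ^ n}"])
  ultimately show ?thesis
    by (simp add: edges_mask_graph card_image card_SigmaI)
qed

text \<open>Either end may be the lower one; \<open>flip_bit\<close> and \<open>unset_bit\<close>
  treat both cases alike.\<close>

lemma edge_mask_graphD:
  assumes "{vec n a, vec n b} \<in> edges (mask_graph M)" "a < 2 ^ n" "b < 2 ^ n"
  shows "\<exists>i<n. b = flip_bit i a \<and> bit (M ! i) (unset_bit i a)"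
proof -
  obtain i v where i: "i < n" "bit (M ! i) v"
    and eq: "{vec n a, vec n b} = {vec n v, vec n (set_bit i v)}"
    using assms(1) by (auto simp: edges_mask_graph)
  have v: "v < 2 ^ n" "\<not> bit v i" "set_bit i v < 2 ^ n"
    using i base set_bit_less_exp by blast+
  have "a = v \<and> b = set_bit i v \<or> a = set_bit i v \<and> b = v"
    using eq assms(2,3) v by (auto simp: doubleton_eq_iff vec_eq_iff)
  then have "b = flip_bit i a \<and> v = unset_bit i a"
    using v(2) by (auto intro!: bit_eqI simp: bit_simps)
  then show ?thesis using i by blast
qed

text \<open>Bit \<open>v\<close> of \<open>drop_bit (2 ^ j) (M ! i)\<close> is bit
  \<open>2 ^ j + v\<close> of \<open>M ! i\<close>, so a square with lowest corner \<open>v\<close>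
  and all four edges present would set bit \<open>v\<close> of the conjunction.\<close>

lemma mask_graph_C4_free:
  assumes square: "\<And>i j. i < j \<Longrightarrow> j < n \<Longrightarrow>
      and (and (M ! i) (M ! j)) (and (drop_bit (2 ^ j) (M ! i)) (drop_bit (2 ^ i) (M ! j))) = 0"
  shows "\<not> contains_copy (mask_graph M) (cycle_graph 4)"
proof
  assume "contains_copy (mask_graph M) (cycle_graph 4)"
  then obtain f where inj: "inj_on f {..<4 :: nat}"
    and f: "f ` {..<4} \<subseteq> verts (mask_graph M)"
      "\<forall>e\<in>{{k, (k + 1) mod 4} | k. k < 4}. f ` e \<in> edges (mask_graph M)"
    unfolding contains_copy_def cycle_graph_def fst_conv snd_conv by blast
  have verts: "length (f k) = n" if "k < 4" for k
    using f(1) that by (auto simp: verts_mask_graph)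
  have edges: "f ` {k, (k + 1) mod 4} \<in> edges (mask_graph M)" if "k < 4" for k
    using f(2) that by blast
  obtain a where a: "a < 2 ^ n" "f 0 = vec n a" using verts[of 0] obtain_vec by auto
  obtain b where b: "b < 2 ^ n" "f 1 = vec n b" using verts[of 1] obtain_vec by auto
  obtain c where c: "c < 2 ^ n" "f 2 = vec n c" using verts[of 2] obtain_vec by auto
  obtain d where d: "d < 2 ^ n" "f 3 = vec n d" using verts[of 3] obtain_vec by auto
  have neq: "a \<noteq> c" "b \<noteq> d"
    using inj_onD[OF inj, of 0 2] inj_onD[OF inj, of 1 3] a b c d by auto
  \<comment> \<open>The last two edges are reversed, so that the cycle becomes two paths from
    \<open>a\<close> to \<open>c\<close>, through \<open>b\<close> and through
    \<open>d\<close>.\<close>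
  have E: "{vec n a, vec n b} \<in> edges (mask_graph M)" "{vec n b, vec n c} \<in> edges (mask_graph M)"
    "{vec n d, vec n c} \<in> edges (mask_graph M)" "{vec n a, vec n d} \<in> edges (mask_graph M)"
    using edges[of 0] edges[of 1] edges[of 2] edges[of 3] a b c d
    by (simp_all add: insert_commute numeral_2_eq_2 [symmetric])
  obtain i where i: "i < n" "b = flip_bit i a" "bit (M ! i) (unset_bit i a)"
    using edge_mask_graphD[OF E(1)] a b by blast
  obtain j where j: "j < n" "c = flip_bit j b" "bit (M ! j) (unset_bit j b)"
    using edge_mask_graphD[OF E(2)] b c by blast
  obtain k where k: "k < n" "c = flip_bit k d" "bit (M ! k) (unset_bit k d)"
    using edge_mask_graphD[OF E(3)] c d by blast
  obtain l where l: "l < n" "d = flip_bit l a" "bit (M ! l) (unset_bit l a)"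
    using edge_mask_graphD[OF E(4)] a d by blast
  have ij: "i \<noteq> j"
    using neq(1) i(2) j(2) by (auto simp: flip_bit_def xor.assoc)
  have il: "i \<noteq> l"
    using neq(2) i(2) l(2) by auto
  \<comment> \<open>Both paths flip the same coordinates. Comparing bits \<open>i\<close> and
    \<open>j\<close> shows that opposite edges of the cycle have the same direction.\<close>
  have flips: "flip_bit j (flip_bit i a) = flip_bit k (flip_bit l a)"
    using i(2) j(2) k(2) l(2) by simp
  then have "bit (flip_bit j (flip_bit i a)) m = bit (flip_bit k (flip_bit l a)) m" for m
    by simp
  from this[of i] this[of j] have kl: "k = i" "l = j"
    using ij il by (auto simp: bit_simps split: if_splits)
  \<comment> \<open>The lowest corner of the square.\<close>
  define v where "v = unset_bit i (unset_bit j a)"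
  have v: "\<not> bit v i" "\<not> bit v j"
    by (auto simp: v_def bit_simps)
  have set: "set_bit j v = 2 ^ j + v" "set_bit i v = 2 ^ i + v"
    using v by (simp_all add: set_bit_eq)
  have "{unset_bit i a, unset_bit i d} = {v, set_bit j v}"
    "{unset_bit j a, unset_bit j b} = {v, set_bit i v}"
    using unset_bit_flip_bit_cases[of i j a] unset_bit_flip_bit_cases[of j i a] ij
    by (simp_all add: v_def i(2) l(2) kl unset_bit_commute)
  then have "bit (M ! i) v" "bit (M ! i) (2 ^ j + v)" "bit (M ! j) v" "bit (M ! j) (2 ^ i + v)"
    using i(3) j(3) k(3) l(3) kl set by (auto simp: doubleton_eq_iff)
  \<comment> \<open>Both orders are recorded because \<open>square\<close> requires the smaller
    direction first, and the cycle may start with either.\<close>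
  then have "bit (and (and (M ! i) (M ! j))
        (and (drop_bit (2 ^ j) (M ! i)) (drop_bit (2 ^ i) (M ! j)))) v"
    "bit (and (and (M ! j) (M ! i))
        (and (drop_bit (2 ^ i) (M ! j)) (drop_bit (2 ^ j) (M ! i)))) v"
    by (simp_all add: bit_and_iff bit_drop_bit_eq)
  moreover have "i < j \<or> j < i" using ij by auto
  ultimately show False
    using square[of i j] square[of j i] i(1) j(1) by auto
qed

end

section \<open>Evaluation on numerals\<close>

text \<open>The offset \<open>k\<close> makes the quantifier over the bits of a numeral computable digit by digit.\<close>

definition all_bits :: "nat \<Rightarrow> nat \<Rightarrow> (nat \<Rightarrow> bool) \<Rightarrow> bool" where
  "all_bits k m P \<longleftrightarrow> (\<forall>v. bit m v \<longrightarrow> P (k + v))"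

lemma bit_numeral_double_iff:
  "bit (numeral (num.Bit0 m) :: nat) v \<longleftrightarrow> (\<exists>w. v = Suc w \<and> bit (numeral m :: nat) w)"
  "bit (numeral (num.Bit1 m) :: nat) v \<longleftrightarrow> v = 0 \<or> (\<exists>w. v = Suc w \<and> bit (numeral m :: nat) w)"
  by (cases v; simp)+

lemma all_bits_numeral [simp]:
  "all_bits k 1 P \<longleftrightarrow> P k"
  "all_bits k (numeral (num.Bit0 m)) P \<longleftrightarrow> all_bits (k + 1) (numeral m) P"
  "all_bits k (numeral (num.Bit1 m)) P \<longleftrightarrow> P k \<and> all_bits (k + 1) (numeral m) P"
proof -
  show "all_bits k 1 P \<longleftrightarrow> P k"
    by (simp add: all_bits_def bit_1_iff del: One_nat_def)
qed (auto simp: all_bits_def bit_numeral_double_iff)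

lemma card_bits_numeral [simp]:
  "card {v. bit (1 :: nat) v} = 1"
  "card {v. bit (numeral (num.Bit0 m) :: nat) v} = card {v. bit (numeral m :: nat) v}"
  "card {v. bit (numeral (num.Bit1 m) :: nat) v} = 1 + card {v. bit (numeral m :: nat) v}"
proof -
  have double: "{v. bit (numeral (num.Bit0 m) :: nat) v} = Suc ` {v. bit (numeral m :: nat) v}"
    "{v. bit (numeral (num.Bit1 m) :: nat) v} = insert 0 (Suc ` {v. bit (numeral m :: nat) v})"
    by (auto simp: bit_numeral_double_iff)
  \<comment> \<open>Since \<open>m < 2 ^ m\<close>, every set bit of \<open>m\<close> has index
    below \<open>m\<close>.\<close>
  have fin: "finite {v. bit m v}" for m :: nat
    using bit_imp_less_of_less_exp[OF less_exp, of m]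
    by (auto intro: finite_subset[of _ "{..<m}"])
  show "card {v. bit (numeral (num.Bit0 m) :: nat) v} = card {v. bit (numeral m :: nat) v}"
    unfolding double by (simp add: card_image)
  show "card {v. bit (numeral (num.Bit1 m) :: nat) v} = 1 + card {v. bit (numeral m :: nat) v}"
    unfolding double using fin by (simp add: card_image)
qed (simp add: bit_1_iff del: One_nat_def)

text \<open>For explicit \<open>M\<close> the hypotheses are decided by simplification:
  \<open>list_all\<close> unfolds over the directions, \<open>all_bits\<close> over the digits of
  each mask.\<close>

lemma ex_num_hypercube_C4_ge:
  assumes "length M = n"
    and "list_all (\<lambda>i. all_bits 0 (M ! i) (\<lambda>v. v < 2 ^ n \<and> \<not> bit v i)) [0..<n]"
    and "list_all (\<lambda>j. list_all (\<lambda>i.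
      and (and (M ! i) (M ! j)) (and (drop_bit (2 ^ j) (M ! i)) (drop_bit (2 ^ i) (M ! j))) = 0)
      [0..<j]) [0..<n]"
  shows "(\<Sum>m\<leftarrow>M. card {v. bit m v}) \<le> ex_num (hypercube n) (cycle_graph 4)"
proof -
  interpret cube_masks M n
    using assms(1,2) by unfold_locales (auto simp: all_bits_def list_all_iff)
  have "(\<Sum>m\<leftarrow>M. card {v. bit m v}) = card (edges (mask_graph M))"
    using assms(1) by (simp add: card_edges_mask_graph sum_list_sum_nth atLeast0LessThan)
  also have "\<dots> \<le> ex_num (hypercube n) (cycle_graph 4)"
    using assms(3)
    by (intro card_le_ex_num finite_edges_hypercube subgraph_mask_graph mask_graph_C4_free)
      (simp add: list_all_iff)
  finally show ?thesis .
qed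

section \<open>The explicit graphs in dimensions 7 and 8\<close>

text \<open>The 32 hexadecimal digits give one bit per vertex. In mask \<open>i\<close> the upper
  half of each block of \<open>2 ^ (i + 1)\<close> bits is zero, since those vertices have bit
  \<open>i\<close> set.\<close>

definition masks7 :: "nat list" where
  "masks7 =
    [0x51545451545151544515154515454515,
     0x13201313131320133201323232320132,
     0x0E0B0B0E0B0E0E0B070D0D070D07070D,
     0x005F006C0093005F00FA00C9003600FA,
     0x0000935F00005F6C000036FA0000FAC9,
     0x000000006C5F5F9300000000C9FAFA36,
     0x0000000000000000BDE7E7BDE7BDBDE7]"

definition masks8 :: "nat list" where
  "masks8 =
    [0x5441551455145141541455415541511414514155415514544151145514554154,
     0x2303113312301333133312301133230303133322302133233323302133220313,
     0x070F06090A000E090B060A0009060D0F0F0E090600050907060D000506090F0B,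
     0x00BC00EB00EB00B600E900BE00BE00E300D3007D007D00D6007900D700D7007C,
     0x00005BF600006D9F0000976F00005EF90000F6AD00009F6B00006F9E0000F9A7,
     0x0000000057FF9E69000000006B965DFF00000000FFAE699700000000966DFFAB,
     0x000000000000000056F9659F956F59F60000000000000000F9A69F6A6F9AF6A9,
     0x00000000000000000000000000000000E979BED7BED7E37CBCD3EB7DEB7DB6D6]"

theorem theorem1p1:
  shows "ex_num (hypercube 7) (cycle_graph 4) \<ge> 304 \<and> ex_num (hypercube 8) (cycle_graph 4) \<ge> 680"
proof
  have "(\<Sum>m\<leftarrow>masks7. card {v. bit m v}) \<le> ex_num (hypercube 7) (cycle_graph 4)"
    \<comment> \<open>The recursion over digits ends at \<open>1\<close>, which
      \<open>One_nat_def\<close> would turn into \<open>Suc 0\<close>, out of reach of the rules for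
      \<open>all_bits\<close> and \<open>card\<close>.\<close>
    by (rule ex_num_hypercube_C4_ge, simp add: masks7_def,
        simp add: masks7_def upt_rec del: One_nat_def, simp add: masks7_def upt_rec)
  then show "304 \<le> ex_num (hypercube 7) (cycle_graph 4)"
    by (simp add: masks7_def del: One_nat_def)
  have "(\<Sum>m\<leftarrow>masks8. card {v. bit m v}) \<le> ex_num (hypercube 8) (cycle_graph 4)"
    by (rule ex_num_hypercube_C4_ge, simp add: masks8_def,
        simp add: masks8_def upt_rec del: One_nat_def, simp add: masks8_def upt_rec)
  then show "680 \<le> ex_num (hypercube 8) (cycle_graph 4)"
    by (simp add: masks8_def del: One_nat_def)
qed

end
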